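(* Let $\mathcal{H}$ be an infinite dimensional Hilbert space, let $\{g_n\}_{n\in\mathbb{N}}\subset\mathcal{H}$ be a sequence and let $A:\mathcal{D}(A)\subseteq\mathcal{H}\to\mathcal{H}$ be a closable densely defined linear operator. Then the following statements are equivalent. (i) $\{g_n\}$ is a weak atomic system for $A$. (ii) $\{g_n\}$ is a weak $A$-frame for $\mathcal{H}$. (iii) $\sum_{n=1}^\infty |\langle f|g_n\rangle|^2<\infty$ for every $f\in\mathcal{D}(A^* )$, and there exists a sequence $\{t_n\}\subset\mathcal{H}$ which is both a Bessel sequence of $\mathcal{H}$ and a weak $A$-dual of $\{g_n\}$.
   Context: $\mathcal{H}$ is a complex Hilbert space with inner product $\langle\cdot|\cdot\rangle$ (linear in the first argument) and norm $\|\cdot\|$; $\ell^2$ is the Hilbert space of square-summable complex sequences. $A^*$ denotes the adjoint of the densely defined operator $A$, with domain $\mathcal{D}(A^* )$. A sequence $\{g_n\}\subset\mathcal{H}$ is a weak $A$-frame for $\mathcal{H}$ if there is $\alpha>0$ such that $\alpha\|A^*f\|^2\le\sum_{n=1}^\infty|\langle f|g_n\rangle|^2<\infty$ for every $f\in\mathcal{D}(A^* )$. A sequence $\{g_n\}\subset\mathcal{H}$ is a weak atomic system for $A$ if: (a) $\sum_{n=1}^\infty|\langle f|g_n\rangle|^2<\infty$ for every $f\in\mathcal{D}(A^* )$; and (b) there exists $\gamma>0$ such that for every $h\in\mathcal{D}(A)$ there exists $a_h=\{a_n(h)\}\in\ell^2$ satisfying $\|a_h\|\le\gamma\|h\|$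 and $\langle Ah|u\rangle=\sum_{n=1}^\infty a_n(h)\langle g_n|u\rangle$ for all $u\in\mathcal{D}(A^* )$. A sequence $\{t_n\}\subset\mathcal{H}$ is a weak $A$-dual of $\{g_n\}$ if $\langle Ah|u\rangle=\sum_{n=1}^\infty\langle h|t_n\rangle\langle g_n|u\rangle$ for all $h\in\mathcal{D}(A)$, $u\in\mathcal{D}(A^* )$. A sequence $\{t_n\}\subset\mathcal{H}$ is a Bessel sequence of $\mathcal{H}$ if there is $\beta>0$ with $\sum_{n=1}^\infty|\langle f|t_n\rangle|^2\le\beta\|f\|^2$ for all $f\in\mathcal{H}$. *)

theory Defs
  imports "HOL-Analysis.Analysis"
begin

class complex_vector = real_vector +
  fixes scaleC :: "complex \<Rightarrow> 'a \<Rightarrow> 'a" (infixr "*\<^sub>C" 75)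
  assumes scaleC_add_right: "c *\<^sub>C (x + y) = c *\<^sub>C x + c *\<^sub>C y"
    and scaleC_add_left: "(c + d) *\<^sub>C x = c *\<^sub>C x + d *\<^sub>C x"
    and scaleC_scaleC: "c *\<^sub>C d *\<^sub>C x = (c * d) *\<^sub>C x"
    and scaleC_one: "1 *\<^sub>C x = x"
    and scaleR_scaleC: "scaleR r x = complex_of_real r *\<^sub>C x"

global_interpretation complex_vector: vector_space "scaleC :: complex \<Rightarrow> 'a::complex_vector \<Rightarrow> 'a"
  by unfold_locales (simp_all add: scaleC_add_right scaleC_add_left scaleC_scaleC scaleC_one)

text \<open>The inner product is linear in the first and conjugate linear in the second argument.
  The norm axioms inherited from \<open>real_normed_vector\<close> are consequences of \<open>norm_eq_sqrt_cinner\<close>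
  and the inner product axioms; inheriting them is no additional restriction.\<close>

class complex_inner = complex_vector + real_normed_vector +
  fixes cinner :: "'a \<Rightarrow> 'a \<Rightarrow> complex"
  assumes cinner_commute: "cinner x y = cnj (cinner y x)"
    and cinner_add_left: "cinner (x + y) z = cinner x z + cinner y z"
    and cinner_scaleC_left: "cinner (scaleC c x) y = c * cinner x y"
    and cinner_ge_zero: "0 \<le> Re (cinner x x)"
    and cinner_eq_zero_iff: "cinner x x = 0 \<longleftrightarrow> x = 0"
    and norm_eq_sqrt_cinner: "norm x = sqrt (Re (cinner x x))"

class complex_hilbert = complex_inner + complete_space

definition infinite_dimensional :: "'a::complex_vector itself \<Rightarrow> bool" where
  "infinite_dimensional _ \<longleftrightarrow>
     (\<nexists>B :: 'a set. finite B \<and> complex_vector.span B = UNIV)"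

text \<open>An operator is a pair of a domain \<open>D\<close> and a function \<open>A\<close> whose values outside \<open>D\<close>
  are irrelevant.\<close>

definition linear_operator :: "'a::complex_vector set \<Rightarrow> ('a \<Rightarrow> 'a) \<Rightarrow> bool" where
  "linear_operator D A \<longleftrightarrow> complex_vector.subspace D \<and>
     (\<forall>x\<in>D. \<forall>y\<in>D. A (x + y) = A x + A y) \<and>
     (\<forall>c. \<forall>x\<in>D. A (c *\<^sub>C x) = c *\<^sub>C A x)"

definition densely_defined :: "'a::complex_inner set \<Rightarrow> bool" where
  "densely_defined D \<longleftrightarrow> closure D = UNIV"

definition operator_graph :: "'a set \<Rightarrow> ('a \<Rightarrow> 'a) \<Rightarrow> ('a \<times> 'a) set" where
  "operator_graph D A = {(x, A x) | x. x \<in> D}"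

definition closable :: "'a::complex_inner set \<Rightarrow> ('a \<Rightarrow> 'a) \<Rightarrow> bool" where
  "closable D A \<longleftrightarrow> single_valued (closure (operator_graph D A))"

definition adjoint_domain :: "'a::complex_inner set \<Rightarrow> ('a \<Rightarrow> 'a) \<Rightarrow> 'a set" where
  "adjoint_domain D A = {u. \<exists>v. \<forall>h\<in>D. cinner (A h) u = cinner h v}"

definition adjoint_op :: "'a::complex_inner set \<Rightarrow> ('a \<Rightarrow> 'a) \<Rightarrow> 'a \<Rightarrow> 'a" where
  "adjoint_op D A u = (THE v. \<forall>h\<in>D. cinner (A h) u = cinner h v)"

text \<open>The definite description is well defined for densely defined operators:\<close>

lemma adjoint_unique:
  fixes D :: "'a::complex_inner set"
  assumes "densely_defined D"
    and v: "\<forall>h\<in>D. cinner (A h) u = cinner h v" and w: "\<forall>h\<in>D. cinner (A h) u = cinner h w"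
  shows "v = w"
proof (rule ccontr)
  define z where "z = v - w"
  assume "v \<noteq> w"
  then have z0: "norm z > 0" by (simp add: z_def)
  have eq: "cinner h v = cinner h w" if "h \<in> D" for h
    using v w that by simp
  have add_right: "cinner x (y + y') = cinner x y + cinner x y'" for x y y' :: 'a
    using cinner_add_left[of y y' x] cinner_commute[of x "y + y'"] cinner_commute[of x y]
      cinner_commute[of x y'] by (metis complex_cnj_add)
  have orth: "cinner h z = 0" if "h \<in> D" for h
    using eq[OF that] add_right[of h z w] by (simp add: z_def)
  have nz: "Re (cinner x x) = (norm x)\<^sup>2" for x :: 'a
    using cinner_ge_zero[of x] by (simp add: norm_eq_sqrt_cinner)
  have "z \<in> closure D" using assms(1) by (simp add: densely_defined_def)
  then obtain h where h: "h \<in> D" "dist h z < norm z"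
    using z0 unfolding closure_approachable by blast
  let ?d = "h - z"
  have hz: "cinner h z = 0" "cinner z h = 0"
    using orth[OF h(1)] cinner_commute[of z h] by simp_all
  have dh: "cinner ?d ?d + cinner ?d z = cinner ?d h" using add_right[of ?d ?d z] by simp
  have "cinner ?d z + cinner z z = cinner h z" "cinner ?d h + cinner z h = cinner h h"
    using cinner_add_left[of ?d z z] cinner_add_left[of ?d z h] by simp_all
  then have "cinner ?d ?d = cinner h h + cinner z z"
    using dh hz by algebra
  then have "Re (cinner ?d ?d) = Re (cinner h h) + Re (cinner z z)" by simp
  then have "(norm ?d)\<^sup>2 = (norm h)\<^sup>2 + (norm z)\<^sup>2" by (simp only: nz)
  then have "(norm z)\<^sup>2 \<le> (norm ?d)\<^sup>2" by simp
  then have "norm z \<le> norm ?d" by (rule power2_le_imp_le) simp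
  then show False using h(2) by (simp add: dist_norm)
qed

lemma adjoint_op_eqI:
  assumes "densely_defined D" "\<forall>h\<in>D. cinner (A h) u = cinner h v"
  shows "adjoint_op D A u = v"
  unfolding adjoint_op_def
proof (rule the_equality)
  show "\<forall>h\<in>D. cinner (A h) u = cinner h v" by (rule assms(2))
next
  fix w assume "\<forall>h\<in>D. cinner (A h) u = cinner h w"
  then show "w = v" using assms by (rule_tac adjoint_unique[of D A u])
qed

text \<open>Sequences are indexed from \<open>0\<close>.\<close>

definition ell2 :: "(nat \<Rightarrow> complex) set" where
  "ell2 = {a. summable (\<lambda>n. (cmod (a n))\<^sup>2)}"

definition ell2_norm :: "(nat \<Rightarrow> complex) \<Rightarrow> real" where
  "ell2_norm a = sqrt (\<Sum>n. (cmod (a n))\<^sup>2)"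

definition weak_frame ::
    "'a::complex_inner set \<Rightarrow> ('a \<Rightarrow> 'a) \<Rightarrow> (nat \<Rightarrow> 'a) \<Rightarrow> bool" where
  "weak_frame D A g \<longleftrightarrow> (\<exists>\<alpha>>0. \<forall>f \<in> adjoint_domain D A.
     summable (\<lambda>n. (cmod (cinner f (g n)))\<^sup>2) \<and>
     \<alpha> * (norm (adjoint_op D A f))\<^sup>2 \<le> (\<Sum>n. (cmod (cinner f (g n)))\<^sup>2))"

definition weak_atomic_system ::
    "'a::complex_inner set \<Rightarrow> ('a \<Rightarrow> 'a) \<Rightarrow> (nat \<Rightarrow> 'a) \<Rightarrow> bool" where
  "weak_atomic_system D A g \<longleftrightarrow>
     (\<forall>f \<in> adjoint_domain D A. summable (\<lambda>n. (cmod (cinner f (g n)))\<^sup>2)) \<and>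
     (\<exists>\<gamma>>0. \<forall>h\<in>D. \<exists>a\<in>ell2. ell2_norm a \<le> \<gamma> * norm h \<and>
        (\<forall>u \<in> adjoint_domain D A. (\<lambda>n. a n * cinner (g n) u) sums cinner (A h) u))"

definition weak_dual ::
    "'a::complex_inner set \<Rightarrow> ('a \<Rightarrow> 'a) \<Rightarrow> (nat \<Rightarrow> 'a) \<Rightarrow> (nat \<Rightarrow> 'a) \<Rightarrow> bool" where
  "weak_dual D A g t \<longleftrightarrow> (\<forall>h\<in>D. \<forall>u \<in> adjoint_domain D A.
     (\<lambda>n. cinner h (t n) * cinner (g n) u) sums cinner (A h) u)"

definition bessel_sequence :: "(nat \<Rightarrow> 'a::complex_inner) \<Rightarrow> bool" where
  "bessel_sequence t \<longleftrightarrow> (\<exists>\<beta>>0. \<forall>f.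
     summable (\<lambda>n. (cmod (cinner f (t n)))\<^sup>2) \<and>
     (\<Sum>n. (cmod (cinner f (t n)))\<^sup>2) \<le> \<beta> * (norm f)\<^sup>2)"

end

theory Submission
  imports Defs
begin

text \<open>The substantial implication is from (ii) to (iii). Write \<open>T f = (\<langle>f|g\<^sub>n\<rangle>)\<^sub>n\<close> for \<open>f\<close> in the
  domain of the adjoint. The frame inequality says that \<open>T f \<mapsto> A\<^sup>* f\<close> is well defined and bounded on
  the range of \<open>T\<close>, hence extends to all of \<open>\<ell>\<^sup>2\<close> after projecting onto the closure of the range;
  the images \<open>t\<^sub>n\<close> of the unit vectors form a Bessel sequence with
  \<open>A\<^sup>* f = (\<Sum>n. \<langle>f|g\<^sub>n\<rangle> t\<^sub>n)\<close>, which is the weak duality. Near-minimizers of the distance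
  to the range replace the projection, so only the completeness of the target space is used.\<close>

section \<open>Complex inner product spaces\<close>

lemma cinner_add_right: "cinner x (y + z) = cinner x y + cinner x z"
  by (metis cinner_add_left cinner_commute complex_cnj_add)

lemma cinner_scaleC_right: "cinner x (c *\<^sub>C y) = cnj c * cinner x y"
  by (metis cinner_commute cinner_scaleC_left complex_cnj_mult)

lemma cinner_zero_right [simp]: "cinner x 0 = 0"
  using cinner_add_right[of x 0 0] by simp

lemma cinner_sum_right: "cinner x (sum f I) = (\<Sum>i\<in>I. cinner x (f i))"
  by (induction I rule: infinite_finite_induct) (simp_all add: cinner_add_right)

lemma Re_cinner_self: "Re (cinner x x) = (norm x)\<^sup>2"
  using cinner_ge_zero[of x] by (simp add: norm_eq_sqrt_cinner)

lemma cinner_self: "cinner x x = complex_of_real ((norm x)\<^sup>2)"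
proof (rule complex_eqI)
  show "Im (cinner x x) = Im (complex_of_real ((norm x)\<^sup>2))"
    using arg_cong[OF cinner_commute[of x x], of Im] by simp
qed (simp add: Re_cinner_self)

lemma norm_scaleC: "norm (c *\<^sub>C x) = cmod c * norm (x :: 'a::complex_inner)"
proof -
  have "complex_of_real ((norm (c *\<^sub>C x))\<^sup>2) = (c * cnj c) * complex_of_real ((norm x)\<^sup>2)"
    by (simp only: cinner_self[symmetric] cinner_scaleC_left cinner_scaleC_right mult_ac)
  also have "\<dots> = complex_of_real ((cmod c * norm x)\<^sup>2)"
    by (simp add: complex_norm_square[symmetric] power_mult_distrib)
  finally have "(norm (c *\<^sub>C x))\<^sup>2 = (cmod c * norm x)\<^sup>2"
    by (simp only: of_real_eq_iff)
  then show ?thesis by simp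
qed

text \<open>The triangle inequality is an axiom of \<open>real_normed_vector\<close>; squaring it
  and expanding the left side gives the real part of Cauchy-Schwarz.\<close>

lemma Re_cinner_le: "Re (cinner x y) \<le> norm x * norm y"
proof -
  have "(norm (x + y))\<^sup>2 \<le> (norm x + norm y)\<^sup>2"
    by (intro power_mono norm_triangle_ineq) simp
  moreover have "(norm (x + y))\<^sup>2 = (norm x)\<^sup>2 + (norm y)\<^sup>2 + 2 * Re (cinner x y)"
    using arg_cong[OF cinner_commute[of y x], of Re]
    by (simp add: Re_cinner_self[symmetric] cinner_add_left cinner_add_right)
  ultimately show ?thesis by (simp add: power2_sum)
qed

lemma cinner_Cauchy_Schwarz: "cmod (cinner x y) \<le> norm x * norm y"
proof (cases "cinner x y = 0")
  case False
  \<comment> \<open>A unimodular factor that rotates \<open>cinner x y\<close> onto the positive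
    real axis, reducing its modulus to a real part.\<close>
  define c where "c = cnj (sgn (cinner x y))"
  have "c * cinner x y = complex_of_real (cmod (cinner x y))"
    using False by (simp add: c_def sgn_eq mult.commute[of "cnj _"] power2_eq_square
        flip: complex_norm_square)
  then have "cmod (cinner x y) = Re (cinner (c *\<^sub>C x) y)"
    by (simp add: cinner_scaleC_left)
  also have "\<dots> \<le> norm (c *\<^sub>C x) * norm y" by (rule Re_cinner_le)
  also have "\<dots> = norm x * norm y"
    using False by (simp add: norm_scaleC c_def norm_sgn)
  finally show ?thesis .
qed simp

lemma minus_eq_scaleC: "- x = (- 1) *\<^sub>C (x :: 'a::complex_vector)"
  using scaleR_scaleC[of "- 1" x] by simp

text \<open>Conjugate linearity still implies real linearity, so the real notion
  \<open>bounded_linear\<close> applies. It carries limits and series through the second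
  argument.\<close>

lemma bounded_linear_cinner_right: "bounded_linear (cinner x)"
proof (rule bounded_linear_intro[where K = "norm x"])
  fix r y show "cinner x (r *\<^sub>R y) = r *\<^sub>R cinner x y"
    by (simp add: scaleR_scaleC cinner_scaleC_right scaleR_conv_of_real)
next
  fix y show "norm (cinner x y) \<le> norm y * norm x"
    using cinner_Cauchy_Schwarz[of x y] by (simp add: mult.commute)
qed (rule cinner_add_right)

section \<open>Square-summable sequences\<close>

text \<open>Convergence is guaranteed for arguments in \<open>ell2\<close>, by
  \<open>ell2_mult\<close> below; membership is therefore a hypothesis of the laws that
  follow.\<close>

definition ell2_inner :: "(nat \<Rightarrow> complex) \<Rightarrow> (nat \<Rightarrow> complex) \<Rightarrow> complex" where
  "ell2_inner x y = (\<Sum>n. x n * cnj (y n))"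

lemma ell2_cnj: "x \<in> ell2 \<Longrightarrow> (\<lambda>n. cnj (x n)) \<in> ell2"
  by (simp add: ell2_def)

lemma ell2_norm_cnj [simp]: "ell2_norm (\<lambda>n. cnj (x n)) = ell2_norm x"
  by (simp add: ell2_norm_def)

text \<open>The square of a sum is at most twice the sum of the squares. The coefficient
  \<open>c\<close> lets one statement cover sums, differences and multiples.\<close>

lemma ell2_add_mult:
  assumes "x \<in> ell2" "y \<in> ell2"
  shows "(\<lambda>n. x n + c * y n) \<in> ell2"
proof -
  have "(cmod (x n + c * y n))\<^sup>2 \<le> 2 * (cmod (x n))\<^sup>2 + 2 * (cmod c)\<^sup>2 * (cmod (y n))\<^sup>2" for n
  proof -
    have "(cmod (x n + c * y n))\<^sup>2 \<le> (cmod (x n) + cmod c * cmod (y n))\<^sup>2"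
      by (intro power_mono) (simp_all add: norm_triangle_le norm_mult)
    also have "\<dots> \<le> 2 * (cmod (x n))\<^sup>2 + 2 * (cmod c * cmod (y n))\<^sup>2"
      using sum_squares_bound[of "cmod (x n)" "cmod c * cmod (y n)"] by (simp add: power2_sum)
    finally show ?thesis by (simp add: power_mult_distrib)
  qed
  moreover have "summable (\<lambda>n. 2 * (cmod (x n))\<^sup>2 + 2 * (cmod c)\<^sup>2 * (cmod (y n))\<^sup>2)"
    using assms by (intro summable_add summable_mult) (simp_all add: ell2_def)
  ultimately show ?thesis
    unfolding ell2_def by (auto intro: summable_comparison_test')
qed

lemma ell2_diff: "x \<in> ell2 \<Longrightarrow> y \<in> ell2 \<Longrightarrow> (\<lambda>n. x n - y n) \<in> ell2"
  using ell2_add_mult[of x y "-1"] by simp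

lemma ell2_norm_nonneg [simp]: "x \<in> ell2 \<Longrightarrow> 0 \<le> ell2_norm x"
  by (simp add: ell2_def ell2_norm_def suminf_nonneg)

lemma ell2_norm_power2: "x \<in> ell2 \<Longrightarrow> (ell2_norm x)\<^sup>2 = (\<Sum>n. (cmod (x n))\<^sup>2)"
  by (simp add: ell2_def ell2_norm_def suminf_nonneg)

text \<open>Cauchy-Schwarz for finite sums bounds all partial sums by the same product of norms,
  which yields both convergence and the bound.\<close>

lemma ell2_mult:
  assumes x: "x \<in> ell2" and y: "y \<in> ell2"
  shows "summable (\<lambda>n. cmod (x n * y n))"
    and "(\<Sum>n. cmod (x n * y n)) \<le> ell2_norm x * ell2_norm y"
proof -
  have part: "L2_set (\<lambda>n. cmod (z n)) {..<N} \<le> ell2_norm z" if "z \<in> ell2" for z N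
    using that unfolding L2_set_def ell2_norm_def ell2_def
    by (intro real_sqrt_le_mono sum_le_suminf) auto
  have le: "(\<Sum>n<N. cmod (x n * y n)) \<le> ell2_norm x * ell2_norm y" for N
  proof -
    have "(\<Sum>n<N. cmod (x n * y n))
        \<le> L2_set (\<lambda>n. cmod (x n)) {..<N} * L2_set (\<lambda>n. cmod (y n)) {..<N}"
      using L2_set_mult_ineq[of "\<lambda>n. cmod (x n)" "\<lambda>n. cmod (y n)" "{..<N}"]
      by (simp add: norm_mult)
    also have "\<dots> \<le> ell2_norm x * ell2_norm y"
      by (intro mult_mono part x y) (simp_all add: x)
    finally show ?thesis .
  qed
  then show sm: "summable (\<lambda>n. cmod (x n * y n))"
    by (intro summableI_nonneg_bounded) simp_all
  show "(\<Sum>n. cmod (x n * y n)) \<le> ell2_norm x * ell2_norm y"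
    using sm le by (rule suminf_le_const)
qed

lemma cmod_suminf_mult_le:
  assumes "x \<in> ell2" "y \<in> ell2"
  shows "cmod (\<Sum>n. x n * y n) \<le> ell2_norm x * ell2_norm y"
  using summable_norm[OF ell2_mult(1)[OF assms]] ell2_mult(2)[OF assms] by linarith

lemma ell2_Cauchy_Schwarz:
  assumes "x \<in> ell2" "y \<in> ell2"
  shows "cmod (ell2_inner x y) \<le> ell2_norm x * ell2_norm y"
  using cmod_suminf_mult_le[OF assms(1) ell2_cnj[OF assms(2)]] by (simp add: ell2_inner_def)

lemma ell2_inner_add_mult_left:
  assumes "x \<in> ell2" "y \<in> ell2" "z \<in> ell2"
  shows "ell2_inner (\<lambda>n. x n + c * y n) z = ell2_inner x z + c * ell2_inner y z"
proof -
  have s: "summable (\<lambda>n. w n * cnj (z n))" if "w \<in> ell2" for w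
    using ell2_mult(1)[OF that ell2_cnj[OF assms(3)]] by (rule summable_norm_cancel)
  show ?thesis
    unfolding ell2_inner_def
    by (simp add: distrib_right mult.assoc suminf_add[symmetric] suminf_mult
        summable_mult s assms)
qed

lemma ell2_inner_diff_left:
  "x \<in> ell2 \<Longrightarrow> y \<in> ell2 \<Longrightarrow> z \<in> ell2
    \<Longrightarrow> ell2_inner (\<lambda>n. x n - y n) z = ell2_inner x z - ell2_inner y z"
  using ell2_inner_add_mult_left[of x y z "-1"] by simp

lemma ell2_inner_self:
  assumes "x \<in> ell2" shows "ell2_inner x x = complex_of_real ((ell2_norm x)\<^sup>2)"
  using assms unfolding ell2_norm_power2[OF assms] ell2_inner_def ell2_def
  by (simp add: complex_norm_square[symmetric] suminf_of_real)

lemma ell2_inner_commute: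
  assumes "x \<in> ell2" "y \<in> ell2"
  shows "ell2_inner x y = cnj (ell2_inner y x)"
proof -
  have "summable (\<lambda>n. y n * cnj (x n))"
    using ell2_mult(1)[OF assms(2) ell2_cnj[OF assms(1)]] by (rule summable_norm_cancel)
  then have "(\<lambda>n. cnj (y n * cnj (x n))) sums cnj (ell2_inner y x)"
    unfolding ell2_inner_def by (simp only: sums_cnj summable_sums)
  then show ?thesis
    unfolding ell2_inner_def by (simp add: sums_iff mult.commute)
qed

text \<open>Squared distance from \<open>x\<close> to a point on the line through \<open>y\<close>,
  as a quadratic in \<open>c\<close>; minimizing it produces the near projections below.\<close>

lemma ell2_norm_diff_mult_power2:
  assumes x: "x \<in> ell2" and y: "y \<in> ell2"
  shows "(ell2_norm (\<lambda>n. x n - c * y n))\<^sup>2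
    = (ell2_norm x)\<^sup>2 - 2 * Re (cnj c * ell2_inner x y) + (cmod c)\<^sup>2 * (ell2_norm y)\<^sup>2"
proof -
  \<comment> \<open>With the coefficient \<open>- c\<close> left linearity applies directly; the
    right argument is reached through conjugate symmetry.\<close>
  let ?w = "\<lambda>n. x n + (- c) * y n"
  have w: "?w \<in> ell2" using x y by (rule ell2_add_mult)
  have "ell2_inner ?w ?w = cnj (ell2_inner ?w x) - c * cnj (ell2_inner ?w y)"
    using ell2_inner_add_mult_left[OF x y w, of "- c"]
      ell2_inner_commute[OF x w] ell2_inner_commute[OF y w] by simp
  also have "\<dots> = ell2_inner x x - cnj (c * ell2_inner y x) - c * cnj (ell2_inner x y)
      + (c * cnj c) * ell2_inner y y"
    unfolding ell2_inner_add_mult_left[OF x y x] ell2_inner_add_mult_left[OF x y y]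
    using ell2_inner_self[OF x] ell2_inner_self[OF y] by (simp add: algebra_simps)
  also have "cnj (c * ell2_inner y x) = cnj c * ell2_inner x y"
    using ell2_inner_commute[OF x y] by simp
  finally have "Re (ell2_inner ?w ?w) = Re (ell2_inner x x) - Re (cnj c * ell2_inner x y)
      - Re (c * cnj (ell2_inner x y)) + Re ((c * cnj c) * ell2_inner y y)"
    by simp
  moreover have "Re (c * cnj (ell2_inner x y)) = Re (cnj c * ell2_inner x y)" by simp
  moreover have "Re ((c * cnj c) * ell2_inner y y) = (cmod c)\<^sup>2 * (ell2_norm y)\<^sup>2"
    unfolding ell2_inner_self[OF y] complex_norm_square[symmetric] by simp
  ultimately show ?thesis
    unfolding ell2_inner_self[OF w] ell2_inner_self[OF x] by simp
qed

section \<open>Truncations of square-summable sequences\<close>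

lemma ell2_finite_support: "(\<lambda>i. if i < (N::nat) then c i else 0) \<in> ell2"
  unfolding ell2_def using summable_finite[of "{..<N}" "\<lambda>i. (cmod (if i < N then c i else 0))\<^sup>2"]
  by auto

lemma ell2_norm_finite_support:
  "ell2_norm (\<lambda>i. if i < (N::nat) then c i else 0) = sqrt (\<Sum>i<N. (cmod (c i))\<^sup>2)"
  unfolding ell2_norm_def by (subst suminf_finite[of "{..<N}"]) auto

text \<open>The squared norm of the tail is the full sum of squares minus its \<open>N\<close>-th
  partial sum.\<close>

lemma ell2_tail_tendsto_0:
  assumes "x \<in> ell2"
  shows "(\<lambda>N. ell2_norm (\<lambda>n. x n - (if n < N then x n else 0))) \<longlonglongrightarrow> 0"
proof -
  have s: "summable (\<lambda>n. (cmod (x n))\<^sup>2)" using assms by (simp add: ell2_def)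
  have "ell2_norm (\<lambda>n. x n - (if n < N then x n else 0))
      = sqrt ((\<Sum>n. (cmod (x n))\<^sup>2) - (\<Sum>n<N. (cmod (x n))\<^sup>2))" for N
  proof -
    have "(\<lambda>n. if n \<in> {..<N} then (cmod (x n))\<^sup>2 else 0) sums (\<Sum>n<N. (cmod (x n))\<^sup>2)"
      by (rule sums_If_finite_set) simp
    from sums_diff[OF summable_sums[OF s] this]
    have "(\<lambda>n. (cmod (x n - (if n < N then x n else 0)))\<^sup>2)
        sums ((\<Sum>n. (cmod (x n))\<^sup>2) - (\<Sum>n<N. (cmod (x n))\<^sup>2))"
      by (rule sums_cong[THEN iffD1, rotated]) simp
    then show ?thesis by (simp add: ell2_norm_def sums_iff)
  qed
  moreover have "(\<lambda>N. sqrt ((\<Sum>n. (cmod (x n))\<^sup>2) - (\<Sum>n<N. (cmod (x n))\<^sup>2))) \<longlonglongrightarrow>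
      sqrt ((\<Sum>n. (cmod (x n))\<^sup>2) - (\<Sum>n. (cmod (x n))\<^sup>2))"
    by (intro tendsto_intros summable_LIMSEQ s)
  ultimately show ?thesis by simp
qed

section \<open>Extending a bounded map from a subspace of square-summable sequences\<close>

text \<open>In the application \<open>V\<close> is the adjoint domain, \<open>T\<close> sends
  \<open>f\<close> to the coefficients \<open>cinner f (g n)\<close>, and \<open>B\<close> is the
  adjoint. \<open>T\<close> may fail to be injective, but \<open>B_bound\<close> forces
  \<open>B\<close> to vanish wherever \<open>T\<close> does.\<close>

locale ell2_dominated =
  fixes V :: "'a::complex_vector set" and T :: "'a \<Rightarrow> nat \<Rightarrow> complex"
    and B :: "'a \<Rightarrow> 'b::complex_hilbert" and K :: real
  assumes subspace: "complex_vector.subspace V"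
    and T_ell2: "v \<in> V \<Longrightarrow> T v \<in> ell2"
    and T_add: "v \<in> V \<Longrightarrow> w \<in> V \<Longrightarrow> T (v + w) n = T v n + T w n"
    and T_scale: "v \<in> V \<Longrightarrow> T (c *\<^sub>C v) n = c * T v n"
    and B_add: "v \<in> V \<Longrightarrow> w \<in> V \<Longrightarrow> B (v + w) = B v + B w"
    and B_scale: "v \<in> V \<Longrightarrow> B (c *\<^sub>C v) = c *\<^sub>C B v"
    and K_nonneg: "0 \<le> K"
    and B_bound: "v \<in> V \<Longrightarrow> norm (B v) \<le> K * ell2_norm (T v)"
begin

lemma V_add_scale: "v \<in> V \<Longrightarrow> w \<in> V \<Longrightarrow> v + c *\<^sub>C w \<in> V"
  by (meson complex_vector.subspace_add complex_vector.subspace_scale subspace)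

lemma T_add_scale: "v \<in> V \<Longrightarrow> w \<in> V \<Longrightarrow> T (v + c *\<^sub>C w) = (\<lambda>n. T v n + c * T w n)"
  by (auto simp: T_add T_scale complex_vector.subspace_scale[OF subspace])

lemma B_add_scale: "v \<in> V \<Longrightarrow> w \<in> V \<Longrightarrow> B (v + c *\<^sub>C w) = B v + c *\<^sub>C B w"
  by (simp add: B_add B_scale complex_vector.subspace_scale[OF subspace])

lemma V_diff: "v \<in> V \<Longrightarrow> w \<in> V \<Longrightarrow> v - w \<in> V"
  using complex_vector.subspace_diff[OF subspace] .

lemma T_diff: "v \<in> V \<Longrightarrow> w \<in> V \<Longrightarrow> T (v - w) = (\<lambda>n. T v n - T w n)"
  using T_add_scale[of v w "- 1"] by (simp flip: minus_eq_scaleC)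

lemma B_diff: "v \<in> V \<Longrightarrow> w \<in> V \<Longrightarrow> B (v - w) = B v - B w"
  using B_add_scale[of v w "- 1"] by (simp flip: minus_eq_scaleC)

text \<open>An attained substitute for the orthogonal projection of \<open>x\<close> onto the
  closure of the range of \<open>T\<close>: the projection may lie outside the range, whereas for
  \<open>x\<close> in \<open>ell2\<close> some \<open>f\<close> of this kind exists for every
  positive \<open>e\<close>.\<close>

definition near_projection :: "(nat \<Rightarrow> complex) \<Rightarrow> real \<Rightarrow> 'a \<Rightarrow> bool" where
  "near_projection x e f \<longleftrightarrow> f \<in> V \<and>
     (\<forall>v\<in>V. cmod (ell2_inner (\<lambda>n. x n - T f n) (T v)) \<le> e * ell2_norm (T v))"

text \<open>Take \<open>f\<close> with squared distance less than \<open>e\<close> squared above the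
  infimum. Moving \<open>T f\<close> along \<open>T v\<close> by the best coefficient lowers the
  squared distance by \<open>(cmod z)\<close> squared over \<open>b\<close>, and this gain cannot
  exceed the slack.\<close>

lemma near_projection_exists:
  assumes x: "x \<in> ell2" and e: "e > 0"
  shows "\<exists>f. near_projection x e f"
proof -
  define Q where "Q f = (ell2_norm (\<lambda>n. x n - T f n))\<^sup>2" for f
  define d where "d = Inf (Q ` V)"
  have bdd: "bdd_below (Q ` V)" by (rule bdd_belowI[of _ 0]) (auto simp: Q_def)
  have "Q ` V \<noteq> {}" using complex_vector.subspace_0[OF subspace] by auto
  then obtain f where f: "f \<in> V" "Q f < d + e\<^sup>2"
    using cInf_lessD[of "Q ` V" "d + e\<^sup>2"] e by (auto simp: d_def)
  let ?w = "\<lambda>n. x n - T f n"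
  have w: "?w \<in> ell2" using x T_ell2[OF f(1)] by (rule ell2_diff)
  have "cmod (ell2_inner ?w (T v)) \<le> e * ell2_norm (T v)" if v: "v \<in> V" for v
  proof (cases "ell2_norm (T v) = 0")
    case True
    then show ?thesis using ell2_Cauchy_Schwarz[OF w T_ell2[OF v]] by simp
  next
    case False
    define z where "z = ell2_inner ?w (T v)"
    define b where "b = (ell2_norm (T v))\<^sup>2"
    have b: "b > 0" using False by (simp add: b_def)
    \<comment> \<open>the coefficient minimizing the distance from \<open>x - T f\<close> to the line through \<open>T v\<close>\<close>
    define c where "c = z / complex_of_real b"
    have "d \<le> Q (f + c *\<^sub>C v)"
      unfolding d_def using bdd V_add_scale[OF f(1) v] by (intro cInf_lower) auto
    also have "Q (f + c *\<^sub>C v) = (ell2_norm (\<lambda>n. ?w n - c * T v n))\<^sup>2"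
      using f(1) v by (simp add: Q_def T_add_scale algebra_simps)
    also have "\<dots> = Q f - 2 * Re (cnj c * z) + (cmod c)\<^sup>2 * b"
      unfolding ell2_norm_diff_mult_power2[OF w T_ell2[OF v]] by (simp add: Q_def z_def b_def)
    also have "cnj c * z = complex_of_real ((cmod z)\<^sup>2 / b)"
      by (simp add: c_def mult.commute[of "cnj z"] flip: complex_norm_square)
    also have "(cmod c)\<^sup>2 * b = (cmod z)\<^sup>2 / b"
      using b by (simp add: c_def norm_divide power_divide power2_eq_square)
    finally have "(cmod z)\<^sup>2 / b \<le> e\<^sup>2" using f(2) by simp
    then have "(cmod z)\<^sup>2 \<le> (e * ell2_norm (T v))\<^sup>2"
      using b by (simp add: divide_simps b_def power_mult_distrib)
    then show ?thesis
      unfolding z_def by (rule power2_le_imp_le) (use e T_ell2[OF v] in simp)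
  qed
  then show ?thesis using f(1) by (auto simp: near_projection_def)
qed

text \<open>Testing both residuals against \<open>T (f - f')\<close> bounds its norm by
  \<open>e + e'\<close>, and \<open>B_bound\<close> transfers the bound to the target space.\<close>

lemma near_projection_norm_diff_le:
  assumes x: "x \<in> ell2" and f: "near_projection x e f" and f': "near_projection x e' f'"
    and "e \<ge> 0" "e' \<ge> 0"
  shows "norm (B f - B f') \<le> K * (e + e')"
proof -
  have V: "f \<in> V" "f' \<in> V" using f f' by (auto simp: near_projection_def)
  define v where "v = f - f'"
  have v: "v \<in> V" using V by (simp add: v_def V_diff)
  note T = T_ell2[OF V(1)] T_ell2[OF V(2)] T_ell2[OF v]
  \<comment> \<open>The difference of the two residuals is \<open>T v\<close> itself, because
    \<open>x\<close> cancels.\<close>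
  have "ell2_inner (T v) (T v) = ell2_inner (\<lambda>n. x n - T f' n) (T v)
      - ell2_inner (\<lambda>n. x n - T f n) (T v)"
    using V T x by (simp add: v_def T_diff ell2_inner_diff_left)
  then have "(ell2_norm (T v))\<^sup>2 = cmod (ell2_inner (\<lambda>n. x n - T f' n) (T v)
      - ell2_inner (\<lambda>n. x n - T f n) (T v))"
    using ell2_inner_self[OF T(3)] by (metis norm_of_real abs_power2)
  also have "\<dots> \<le> e' * ell2_norm (T v) + e * ell2_norm (T v)"
    using f f' v by (intro order.trans[OF norm_triangle_ineq4] add_mono)
      (auto simp: near_projection_def)
  finally have "ell2_norm (T v) * ell2_norm (T v) \<le> (e + e') * ell2_norm (T v)"
    by (simp add: power2_eq_square algebra_simps)
  then have "ell2_norm (T v) \<le> e + e'"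
    using ell2_norm_nonneg[OF T(3)] assms(4,5)
    by (cases "ell2_norm (T v) = 0") (auto simp: mult_le_cancel_right)
  then have "K * ell2_norm (T v) \<le> K * (e + e')"
    using K_nonneg by (rule mult_left_mono)
  then show ?thesis
    using B_bound[OF v] V by (simp add: v_def B_diff)
qed

text \<open>\<open>extends x y\<close> says that \<open>y\<close> is the value at \<open>x\<close> of the extension by zero on the orthogonal
  complement of the range of \<open>T\<close>.\<close>

definition extends :: "(nat \<Rightarrow> complex) \<Rightarrow> 'b \<Rightarrow> bool" where
  "extends x y \<longleftrightarrow> (\<forall>e>0. \<exists>f. near_projection x e f \<and> norm (B f - y) \<le> e)"

text \<open>Along near projections with tolerances tending to zero, the values of \<open>B\<close>
  form a Cauchy sequence; its limit in the complete target space is \<open>y\<close>.\<close>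

lemma extends_exists:
  assumes x: "x \<in> ell2"
  shows "\<exists>y. extends x y"
proof -
  define r :: "nat \<Rightarrow> real" where "r k = inverse (real (Suc k))" for k
  have r: "r k > 0" for k by (simp add: r_def)
  have r0: "r \<longlonglongrightarrow> 0" unfolding r_def by (rule LIMSEQ_inverse_real_of_nat)
  obtain F where F: "near_projection x (r k) (F k)" for k
    using near_projection_exists[OF x r] by metis
  have "Cauchy (\<lambda>k. B (F k))"
  proof (rule CauchyI)
    fix e :: real assume e: "e > 0"
    have "(\<lambda>k. K * (r k + r k)) \<longlonglongrightarrow> K * (0 + 0)" by (intro tendsto_intros r0)
    then have "\<forall>\<^sub>F k in sequentially. K * (r k + r k) < e"
      by (rule order_tendstoD) (use e in simp)
    then obtain M where M: "K * (r M + r M) < e" by (auto simp: eventually_sequentially)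
    have "norm (B (F m) - B (F n)) < e" if "m \<ge> M" "n \<ge> M" for m n
    proof -
      have "norm (B (F m) - B (F n)) \<le> K * (r m + r n)"
        using near_projection_norm_diff_le[OF x F F] r by (simp add: less_imp_le)
      also have "\<dots> \<le> K * (r M + r M)"
        using that K_nonneg by (intro mult_left_mono add_mono) (simp_all add: r_def le_imp_inverse_le)
      finally show ?thesis using M by simp
    qed
    then show "\<exists>M. \<forall>m\<ge>M. \<forall>n\<ge>M. norm (B (F m) - B (F n)) < e" by blast
  qed
  then obtain y where y: "(\<lambda>k. B (F k)) \<longlonglongrightarrow> y"
    using Cauchy_convergent by (auto simp: convergent_def)
  have "\<exists>f. near_projection x e f \<and> norm (B f - y) \<le> e" if "e > 0" for e
  proof -
    have "\<forall>\<^sub>F k in sequentially. r k < e" using order_tendstoD(2)[OF r0 that] .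
    moreover have "\<forall>\<^sub>F k in sequentially. dist (B (F k)) y < e" using tendstoD[OF y that] .
    ultimately have "\<forall>\<^sub>F k in sequentially. r k < e \<and> dist (B (F k)) y < e"
      by (rule eventually_conj)
    then obtain k where k: "r k < e" "dist (B (F k)) y < e"
      by (auto simp: eventually_sequentially)
    \<comment> \<open>A near projection stays one when the tolerance grows from \<open>r k\<close>
      to \<open>e\<close>.\<close>
    have "near_projection x e (F k)"
      unfolding near_projection_def
    proof (intro conjI ballI)
      show "F k \<in> V" using F[of k] by (simp add: near_projection_def)
      fix v assume "v \<in> V"
      then have "cmod (ell2_inner (\<lambda>n. x n - T (F k) n) (T v)) \<le> r k * ell2_norm (T v)"
        using F[of k] by (simp add: near_projection_def)
      also have "\<dots> \<le> e * ell2_norm (T v)" using k(1) \<open>v \<in> V\<close> by (intro mult_right_mono) (simp_all add: T_ell2)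
      finally show "cmod (ell2_inner (\<lambda>n. x n - T (F k) n) (T v)) \<le> e * ell2_norm (T v)" .
    qed
    then show ?thesis using k(2) by (auto simp: dist_norm)
  qed
  then show ?thesis by (auto simp: extends_def)
qed

text \<open>Here \<open>v\<close> serves for every tolerance, since its residual is zero.\<close>

lemma extends_T: "v \<in> V \<Longrightarrow> extends (T v) (B v)"
  unfolding extends_def near_projection_def
  by (auto simp: ell2_inner_def T_ell2 intro!: exI[of _ v])

text \<open>Near projections combine linearly, with errors adding up. Linearity is phrased for the
  relation, so no function selecting values is required.\<close>

lemma extends_add_scale:
  assumes x: "x \<in> ell2" "extends x y" and x': "x' \<in> ell2" "extends x' y'"
  shows "extends (\<lambda>n. x n + c * x' n) (y + c *\<^sub>C y')"
  unfolding extends_def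
proof (intro allI impI)
  fix e :: real assume "e > 0"
  \<comment> \<open>Chosen so that \<open>d + cmod c * d = e\<close>, the total error both of the
    residuals and of the values of \<open>B\<close>.\<close>
  define d where "d = e / (1 + cmod c)"
  have "1 + cmod c > 0" by (simp add: add_pos_nonneg)
  then have "d > 0" "d * (1 + cmod c) = e" using \<open>e > 0\<close> by (simp_all add: d_def)
  then have d: "d > 0" "d + cmod c * d = e" by (simp_all add: algebra_simps)
  obtain f f' where f: "near_projection x d f" "norm (B f - y) \<le> d"
    and f': "near_projection x' d f'" "norm (B f' - y') \<le> d"
    using x(2) x'(2) d(1) by (meson extends_def)
  have V: "f \<in> V" "f' \<in> V" using f(1) f'(1) by (auto simp: near_projection_def)
  have "near_projection (\<lambda>n. x n + c * x' n) e (f + c *\<^sub>C f')"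
    unfolding near_projection_def
  proof (intro conjI ballI)
    show "f + c *\<^sub>C f' \<in> V" using V by (rule V_add_scale)
    fix v assume v: "v \<in> V"
    let ?p = "\<lambda>n. x n - T f n" and ?q = "\<lambda>n. x' n - T f' n"
    have pq: "?p \<in> ell2" "?q \<in> ell2" using x x' V by (simp_all add: ell2_diff T_ell2)
    have "(\<lambda>n. x n + c * x' n - T (f + c *\<^sub>C f') n) = (\<lambda>n. ?p n + c * ?q n)"
      using V by (simp add: T_add_scale algebra_simps)
    then have "cmod (ell2_inner (\<lambda>n. x n + c * x' n - T (f + c *\<^sub>C f') n) (T v))
        = cmod (ell2_inner ?p (T v) + c * ell2_inner ?q (T v))"
      using ell2_inner_add_mult_left[OF pq T_ell2[OF v]] by simp
    also have "\<dots> \<le> cmod (ell2_inner ?p (T v)) + cmod c * cmod (ell2_inner ?q (T v))"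
      by (metis norm_mult norm_triangle_ineq)
    also have "\<dots> \<le> d * ell2_norm (T v) + cmod c * (d * ell2_norm (T v))"
      using f(1) f'(1) v by (intro add_mono mult_left_mono) (auto simp: near_projection_def)
    also have "\<dots> = e * ell2_norm (T v)" using d(2) by (simp flip: d(2) add: algebra_simps)
    finally show "cmod (ell2_inner (\<lambda>n. x n + c * x' n - T (f + c *\<^sub>C f') n) (T v))
        \<le> e * ell2_norm (T v)" .
  qed
  moreover have "norm (B (f + c *\<^sub>C f') - (y + c *\<^sub>C y')) \<le> e"
  proof -
    have "B (f + c *\<^sub>C f') - (y + c *\<^sub>C y') = (B f - y) + c *\<^sub>C (B f' - y')"
      using V by (simp add: B_add_scale complex_vector.scale_right_diff_distrib)
    then have "norm (B (f + c *\<^sub>C f') - (y + c *\<^sub>C y')) \<le> norm (B f - y) + cmod c * norm (B f' - y')"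
      by (metis norm_scaleC norm_triangle_ineq)
    also have "\<dots> \<le> d + cmod c * d" using f(2) f'(2) by (intro add_mono mult_left_mono) simp_all
    finally show ?thesis by (simp add: d(2))
  qed
  ultimately show "\<exists>f. near_projection (\<lambda>n. x n + c * x' n) e f \<and> norm (B f - (y + c *\<^sub>C y')) \<le> e"
    by blast
qed

text \<open>Approximate version of the contractivity of projections, obtained by testing the
  residual against \<open>T f\<close> itself.\<close>

lemma near_projection_norm_le:
  assumes x: "x \<in> ell2" and f: "near_projection x e f" and e: "e \<ge> 0"
  shows "ell2_norm (T f) \<le> ell2_norm x + e"
proof -
  have V: "f \<in> V" using f by (simp add: near_projection_def)
  note T = T_ell2[OF V]
  have "(ell2_norm (T f))\<^sup>2 = cmod (ell2_inner x (T f) - ell2_inner (\<lambda>n. x n - T f n) (T f))"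
    using ell2_inner_self[OF T] ell2_inner_diff_left[OF x T T]
    by (simp flip: of_real_power)
  also have "\<dots> \<le> ell2_norm x * ell2_norm (T f) + e * ell2_norm (T f)"
    using f V by (intro order.trans[OF norm_triangle_ineq4] add_mono ell2_Cauchy_Schwarz x T)
      (auto simp: near_projection_def)
  finally have "ell2_norm (T f) * ell2_norm (T f) \<le> (ell2_norm x + e) * ell2_norm (T f)"
    by (simp add: power2_eq_square algebra_simps)
  then show ?thesis
    using ell2_norm_nonneg[OF T] ell2_norm_nonneg[OF x] e
    by (cases "ell2_norm (T f) = 0") (auto simp: mult_le_cancel_right)
qed

lemma extends_norm_le:
  assumes x: "x \<in> ell2" and y: "extends x y"
  shows "norm y \<le> K * ell2_norm x"
proof (rule field_le_epsilon)
  fix e :: real assume "e > 0"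
  \<comment> \<open>Gives \<open>K * d + d = e\<close>; the denominator \<open>K + 1\<close> stays
    positive when \<open>K = 0\<close>.\<close>
  define d where "d = e / (K + 1)"
  have "d > 0" "d * (K + 1) = e" using \<open>e > 0\<close> K_nonneg by (simp_all add: d_def)
  then have d: "d > 0" "K * d + d = e" by (simp_all add: algebra_simps)
  obtain f where f: "near_projection x d f" "norm (B f - y) \<le> d"
    using y d(1) by (meson extends_def)
  have V: "f \<in> V" using f(1) by (simp add: near_projection_def)
  have "norm y \<le> norm (B f) + d"
    using norm_triangle_ineq4[of "B f" "B f - y"] f(2) by simp
  also have "norm (B f) \<le> K * (ell2_norm x + d)"
    using near_projection_norm_le[OF x f(1)] d(1) K_nonneg
    by (intro order.trans[OF B_bound[OF V]] mult_left_mono) simp_all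
  finally show "norm y \<le> K * ell2_norm x + e" using d(2) by (simp add: algebra_simps)
qed

text \<open>Each \<open>t n\<close> is a value of the extension at the \<open>n\<close>-th unit
  vector. The first property is the norm bound on finitely supported sequences; the second applies
  that bound to the tails of \<open>T v\<close>.\<close>

lemma expansion:
  obtains t where
    "\<And>c N. norm (\<Sum>n<N. c n *\<^sub>C t n) \<le> K * sqrt (\<Sum>n<N. (cmod (c n))\<^sup>2)"
    "\<And>v. v \<in> V \<Longrightarrow> (\<lambda>n. T v n *\<^sub>C t n) sums B v"
proof -
  define u :: "nat \<Rightarrow> nat \<Rightarrow> complex" where "u n = (\<lambda>i. if i = n then 1 else 0)" for n
  have u: "u n \<in> ell2" for n
    using ell2_finite_support[of "Suc n" "u n"]
    by (rule back_subst[of "\<lambda>x. x \<in> ell2"]) (auto simp: u_def)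
  obtain t where t: "extends (u n) (t n)" for n
    using extends_exists[OF u] by metis
  have sum: "extends (\<lambda>i. if i < N then c i else 0) (\<Sum>n<N. c n *\<^sub>C t n)" for c N
  proof (induction N)
    case 0
    \<comment> \<open>The empty sum is covered because the zero sequence is
      \<open>T 0\<close>.\<close>
    have "T 0 = (\<lambda>n. 0)" "B 0 = 0"
      using T_diff[of 0 0] B_diff[of 0 0] complex_vector.subspace_0[OF subspace] by auto
    then show ?case using extends_T[of 0] complex_vector.subspace_0[OF subspace] by simp
  next
    case (Suc N)
    have "(\<lambda>i. if i < Suc N then c i else 0) = (\<lambda>i. (if i < N then c i else 0) + c N * u N i)"
      by (auto simp: u_def fun_eq_iff less_Suc_eq)
    then show ?case
      using extends_add_scale[OF ell2_finite_support Suc.IH u t, of "c N"] by simp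
  qed
  have "norm (\<Sum>n<N. c n *\<^sub>C t n) \<le> K * sqrt (\<Sum>n<N. (cmod (c n))\<^sup>2)" for c N
    using extends_norm_le[OF ell2_finite_support sum] by (simp add: ell2_norm_finite_support)
  moreover have "(\<lambda>n. T v n *\<^sub>C t n) sums B v" if v: "v \<in> V" for v
  proof -
    have le: "norm ((\<Sum>n<N. T v n *\<^sub>C t n) - B v)
        \<le> K * ell2_norm (\<lambda>n. T v n - (if n < N then T v n else 0))" for N
    proof -
      let ?s = "\<Sum>n<N. T v n *\<^sub>C t n" and ?x = "\<lambda>n. if n < N then T v n else 0"
      \<comment> \<open>The error of the partial sum is a value of the extension at the tail of
        \<open>T v\<close>, so it is at most \<open>K\<close> times the norm of that tail.\<close>
      have "extends (\<lambda>n. T v n - ?x n) (B v - ?s)"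
        using extends_add_scale[OF T_ell2[OF v] extends_T[OF v] ell2_finite_support sum, of "- 1"]
        by (simp flip: minus_eq_scaleC)
      from extends_norm_le[OF ell2_diff[OF T_ell2[OF v] ell2_finite_support] this]
      show ?thesis by (simp add: norm_minus_commute)
    qed
    have "(\<lambda>N. K * ell2_norm (\<lambda>n. T v n - (if n < N then T v n else 0))) \<longlonglongrightarrow> 0"
      using tendsto_mult_right_zero[OF ell2_tail_tendsto_0[OF T_ell2[OF v]]] .
    with always_eventually[OF allI[OF le]] have "(\<lambda>N. (\<Sum>n<N. T v n *\<^sub>C t n) - B v) \<longlonglongrightarrow> 0"
      by (rule Lim_null_comparison)
    then show ?thesis unfolding sums_def by (rule LIM_zero_cancel)
  qed
  ultimately show ?thesis by (rule that)
qed

end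

section \<open>Bessel sequences and adjoints\<close>

text \<open>Duality: a bound \<open>K\<close> for synthesis from finite coefficient families gives
  the same bound for analysis, by choosing the coefficients \<open>cinner f (t n)\<close>.\<close>

lemma bessel_sequenceI:
  assumes K: "K > 0"
    and le: "\<And>c N. norm (\<Sum>n<N. c n *\<^sub>C t n) \<le> K * sqrt (\<Sum>n<N. (cmod (c n))\<^sup>2)"
  shows "bessel_sequence t"
proof -
  have part: "(\<Sum>n<N. (cmod (cinner f (t n)))\<^sup>2) \<le> K\<^sup>2 * (norm f)\<^sup>2" for f N
  proof -
    define S where "S = (\<Sum>n<N. (cmod (cinner f (t n)))\<^sup>2)"
    have S: "S \<ge> 0" by (simp add: S_def sum_nonneg)
    have "complex_of_real S = cinner f (\<Sum>n<N. cinner f (t n) *\<^sub>C t n)"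
      by (simp add: S_def cinner_sum_right cinner_scaleC_right complex_norm_square mult.commute
          flip: of_real_power)
    then have "S = cmod (cinner f (\<Sum>n<N. cinner f (t n) *\<^sub>C t n))"
      using S by (metis abs_of_nonneg norm_of_real)
    also have "\<dots> \<le> norm f * (K * sqrt S)"
      unfolding S_def by (intro order.trans[OF cinner_Cauchy_Schwarz] mult_left_mono le) simp
    finally have "sqrt S * sqrt S \<le> (K * norm f) * sqrt S" using S by (simp add: mult_ac)
    then have "sqrt S \<le> K * norm f"
      using S K by (cases "S = 0") (use mult_right_le_imp_le[of "sqrt S" "sqrt S"] in simp_all)
    then have "(sqrt S)\<^sup>2 \<le> (K * norm f)\<^sup>2" using S by (intro power_mono) simp_all
    then show ?thesis using S by (simp add: S_def[symmetric] power_mult_distrib)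
  qed
  then have sm: "summable (\<lambda>n. (cmod (cinner f (t n)))\<^sup>2)" for f
    by (intro summableI_nonneg_bounded) simp_all
  have "(\<Sum>n. (cmod (cinner f (t n)))\<^sup>2) \<le> K\<^sup>2 * (norm f)\<^sup>2" for f
    using sm part by (rule suminf_le_const)
  then show ?thesis using sm K unfolding bessel_sequence_def by (intro exI[of _ "K\<^sup>2"]) simp
qed

section \<open>The adjoint of a densely defined operator\<close>

context
  fixes D :: "'a::complex_inner set" and A :: "'a \<Rightarrow> 'a"
  assumes dense: "densely_defined D"
begin

lemma cinner_adjoint:
  assumes "h \<in> D" "u \<in> adjoint_domain D A"
  shows "cinner (A h) u = cinner h (adjoint_op D A u)"
  using assms adjoint_op_eqI[OF dense] by (fastforce simp: adjoint_domain_def)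

lemma adjoint_add:
  assumes "u \<in> adjoint_domain D A" "v \<in> adjoint_domain D A"
  shows "u + v \<in> adjoint_domain D A"
    and "adjoint_op D A (u + v) = adjoint_op D A u + adjoint_op D A v"
proof -
  have *: "\<forall>h\<in>D. cinner (A h) (u + v) = cinner h (adjoint_op D A u + adjoint_op D A v)"
    using assms by (simp add: cinner_add_right cinner_adjoint)
  then show "u + v \<in> adjoint_domain D A" unfolding adjoint_domain_def by blast
  show "adjoint_op D A (u + v) = adjoint_op D A u + adjoint_op D A v"
    using dense * by (rule adjoint_op_eqI)
qed

lemma adjoint_scale:
  assumes "u \<in> adjoint_domain D A"
  shows "c *\<^sub>C u \<in> adjoint_domain D A"
    and "adjoint_op D A (c *\<^sub>C u) = c *\<^sub>C adjoint_op D A u"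
proof -
  have *: "\<forall>h\<in>D. cinner (A h) (c *\<^sub>C u) = cinner h (c *\<^sub>C adjoint_op D A u)"
    using assms by (simp add: cinner_scaleC_right cinner_adjoint)
  then show "c *\<^sub>C u \<in> adjoint_domain D A" unfolding adjoint_domain_def by blast
  show "adjoint_op D A (c *\<^sub>C u) = c *\<^sub>C adjoint_op D A u"
    using dense * by (rule adjoint_op_eqI)
qed

lemma subspace_adjoint_domain: "complex_vector.subspace (adjoint_domain D A)"
proof -
  have "0 \<in> adjoint_domain D A" by (auto simp: adjoint_domain_def intro!: exI[of _ 0])
  then show ?thesis by (simp add: complex_vector.subspace_def adjoint_add adjoint_scale)
qed

text \<open>Letting \<open>h\<close> tend to \<open>z\<close> within \<open>D\<close> turns the
  hypothesis into \<open>norm z * norm z \<le> M * norm z\<close>.\<close>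

lemma norm_le_if_dense_bound:
  assumes "M \<ge> 0" "\<And>h. h \<in> D \<Longrightarrow> cmod (cinner h z) \<le> M * norm h"
  shows "norm z \<le> M"
proof -
  have "z \<in> closure D" using dense by (simp add: densely_defined_def)
  then obtain h where h: "\<And>k. h k \<in> D" "h \<longlonglongrightarrow> z"
    unfolding closure_sequential by blast
  have "(\<lambda>k. cinner z (h k)) \<longlonglongrightarrow> cinner z z"
    by (rule bounded_linear.tendsto[OF bounded_linear_cinner_right h(2)])
  then have "(\<lambda>k. cmod (cinner z (h k))) \<longlonglongrightarrow> cmod (cinner z z)" by (rule tendsto_norm)
  moreover have "(\<lambda>k. M * norm (h k)) \<longlonglongrightarrow> M * norm z" by (intro tendsto_intros h(2))
  moreover have "cmod (cinner z (h k)) \<le> M * norm (h k)" for k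
    using assms(2)[OF h(1)] cinner_commute[of z "h k"] by simp
  ultimately have "cmod (cinner z z) \<le> M * norm z" by (blast intro: LIMSEQ_le)
  then have "norm z * norm z \<le> M * norm z"
    by (simp add: cinner_self power2_eq_square norm_mult)
  then show ?thesis
    using assms(1) by (cases "z = 0") (auto simp: mult_le_cancel_right)
qed

section \<open>Implications between atomic systems, frames and duals\<close>

lemma weak_frame_if_weak_atomic_system:
  assumes "weak_atomic_system D A g"
  shows "weak_frame D A g"
proof -
  let ?S = "\<lambda>f. \<Sum>n. (cmod (cinner f (g n)))\<^sup>2"
  have sm: "summable (\<lambda>n. (cmod (cinner f (g n)))\<^sup>2)" if "f \<in> adjoint_domain D A" for f
    using assms that by (simp add: weak_atomic_system_def)
  obtain \<gamma> where \<gamma>: "\<gamma> > 0"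
    and at: "\<forall>h\<in>D. \<exists>a\<in>ell2. ell2_norm a \<le> \<gamma> * norm h \<and>
        (\<forall>u \<in> adjoint_domain D A. (\<lambda>n. a n * cinner (g n) u) sums cinner (A h) u)"
    using assms unfolding weak_atomic_system_def by (elim conjE exE)
  have "inverse (\<gamma>\<^sup>2) * (norm (adjoint_op D A f))\<^sup>2 \<le> ?S f" if f: "f \<in> adjoint_domain D A" for f
  proof -
    have eq: "cmod (cinner (g n) f) = cmod (cinner f (g n))" for n
      using cinner_commute[of "g n" f] by simp
    have gf: "(\<lambda>n. cinner (g n) f) \<in> ell2" using sm[OF f] by (simp add: ell2_def eq)
    have S: "ell2_norm (\<lambda>n. cinner (g n) f) = sqrt (?S f)" by (simp add: ell2_norm_def eq)
    have S0: "?S f \<ge> 0" using sm[OF f] by (simp add: suminf_nonneg)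
    \<comment> \<open>By density it suffices to test the adjoint against \<open>h\<close> in
      \<open>D\<close>, where the atomic expansion and Cauchy-Schwarz apply. Squaring gives the
      frame constant \<open>inverse\<close> of \<gamma> squared.\<close>
    have "norm (adjoint_op D A f) \<le> \<gamma> * sqrt (?S f)"
    proof (rule norm_le_if_dense_bound)
      fix h assume h: "h \<in> D"
      from bspec[OF at h] obtain a where a: "a \<in> ell2" "ell2_norm a \<le> \<gamma> * norm h"
        "(\<lambda>n. a n * cinner (g n) f) sums cinner (A h) f"
        using f by blast
      have "cmod (cinner h (adjoint_op D A f)) = cmod (\<Sum>n. a n * cinner (g n) f)"
        using a(3) cinner_adjoint[OF h f] by (simp add: sums_iff)
      also have "\<dots> \<le> ell2_norm a * sqrt (?S f)"
        using cmod_suminf_mult_le[OF a(1) gf] S by simp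
      also have "\<dots> \<le> (\<gamma> * norm h) * sqrt (?S f)" using a(2) S0 by (intro mult_right_mono) simp_all
      finally show "cmod (cinner h (adjoint_op D A f)) \<le> \<gamma> * sqrt (?S f) * norm h"
        by (simp add: mult_ac)
    qed (use \<gamma> S0 in simp)
    then have "(norm (adjoint_op D A f))\<^sup>2 \<le> (\<gamma> * sqrt (?S f))\<^sup>2" by (intro power_mono) simp_all
    then show ?thesis using S0 \<gamma> by (simp add: power_mult_distrib field_simps)
  qed
  then show ?thesis
    using sm \<gamma> unfolding weak_frame_def by (intro exI[of _ "inverse (\<gamma>\<^sup>2)"]) simp
qed

end

text \<open>The numbers \<open>cinner h (t n)\<close> serve as atomic coefficients, and the square
  root of the Bessel bound as \<gamma>.\<close>

lemma weak_atomic_system_if_weak_dual: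
  assumes sm: "\<forall>f \<in> adjoint_domain D A. summable (\<lambda>n. (cmod (cinner f (g n)))\<^sup>2)"
    and t: "bessel_sequence t" and dual: "weak_dual D A g t"
  shows "weak_atomic_system D A g"
proof -
  obtain \<beta> where \<beta>: "\<beta> > 0" and sm_t: "\<And>f. summable (\<lambda>n. (cmod (cinner f (t n)))\<^sup>2)"
    and le: "\<And>f. (\<Sum>n. (cmod (cinner f (t n)))\<^sup>2) \<le> \<beta> * (norm f)\<^sup>2"
    using t unfolding bessel_sequence_def by blast
  have "ell2_norm (\<lambda>n. cinner h (t n)) \<le> sqrt \<beta> * norm h" for h
    using real_sqrt_le_mono[OF le[of h]] by (simp add: ell2_norm_def real_sqrt_mult)
  moreover have "(\<lambda>n. cinner h (t n)) \<in> ell2" for h using sm_t by (simp add: ell2_def)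
  ultimately have "\<exists>a\<in>ell2. ell2_norm a \<le> sqrt \<beta> * norm h \<and>
        (\<forall>u \<in> adjoint_domain D A. (\<lambda>n. a n * cinner (g n) u) sums cinner (A h) u)"
    if "h \<in> D" for h
    using that dual unfolding weak_dual_def by (intro bexI[of _ "\<lambda>n. cinner h (t n)"]) simp_all
  then show ?thesis
    using sm \<beta> unfolding weak_atomic_system_def by (intro conjI exI[of _ "sqrt \<beta>"]) auto
qed

lemma weak_dual_if_weak_frame:
  fixes D :: "'a::complex_hilbert set"
  assumes dense: "densely_defined D" and frame: "weak_frame D A g"
  shows "\<exists>t. bessel_sequence t \<and> weak_dual D A g t"
proof -
  let ?V = "adjoint_domain D A" and ?T = "\<lambda>f n. cinner f (g n)" and ?B = "adjoint_op D A"
  obtain \<alpha> where \<alpha>: "\<alpha> > 0"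
    and sm: "\<And>f. f \<in> ?V \<Longrightarrow> summable (\<lambda>n. (cmod (cinner f (g n)))\<^sup>2)"
    and le: "\<And>f. f \<in> ?V \<Longrightarrow> \<alpha> * (norm (?B f))\<^sup>2 \<le> (\<Sum>n. (cmod (cinner f (g n)))\<^sup>2)"
    using frame unfolding weak_frame_def by (elim exE conjE) simp
  \<comment> \<open>The square root of the frame inequality bounds the adjoint by this multiple of
    the coefficient norm.\<close>
  define K where "K = inverse (sqrt \<alpha>)"
  have K: "K > 0" using \<alpha> by (simp add: K_def)
  interpret ell2_dominated ?V ?T ?B K
  proof
    fix f assume f: "f \<in> ?V"
    have "sqrt \<alpha> * norm (?B f) \<le> ell2_norm (?T f)"
      using real_sqrt_le_mono[OF le[OF f]] by (simp add: ell2_norm_def real_sqrt_mult)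
    then show "norm (?B f) \<le> K * ell2_norm (?T f)"
      using \<alpha> by (simp add: K_def field_simps)
  qed (use K sm in \<open>simp_all add: ell2_def cinner_add_left cinner_scaleC_left
      subspace_adjoint_domain[OF dense] adjoint_add[OF dense] adjoint_scale[OF dense]\<close>)
  obtain t where t: "\<And>c N. norm (\<Sum>n<N. c n *\<^sub>C t n) \<le> K * sqrt (\<Sum>n<N. (cmod (c n))\<^sup>2)"
    and sums: "\<And>f. f \<in> ?V \<Longrightarrow> (\<lambda>n. cinner f (g n) *\<^sub>C t n) sums ?B f"
    by (rule expansion) blast
  have "(\<lambda>n. cinner h (t n) * cinner (g n) u) sums cinner (A h) u"
    if h: "h \<in> D" and u: "u \<in> ?V" for h u
  proof -
    \<comment> \<open>Pairing the norm-convergent expansion of the adjoint with \<open>h\<close>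
      conjugates each coefficient, turning \<open>cinner u (g n)\<close> into
      \<open>cinner (g n) u\<close>.\<close>
    have "(\<lambda>n. cinner h (cinner u (g n) *\<^sub>C t n)) sums cinner h (?B u)"
      using bounded_linear.sums[OF bounded_linear_cinner_right sums[OF u]] .
    moreover have "cinner h (cinner u (g n) *\<^sub>C t n) = cinner h (t n) * cinner (g n) u" for n
      using cinner_commute[of "g n" u] by (simp add: cinner_scaleC_right mult.commute)
    ultimately show ?thesis by (simp add: cinner_adjoint[OF dense h u])
  qed
  then have "weak_dual D A g t" by (simp add: weak_dual_def)
  moreover have "bessel_sequence t" using K t by (rule bessel_sequenceI)
  ultimately show ?thesis by blast
qed

theorem theorem3p10:
  fixes D :: "'a::complex_hilbert set" and A :: "'a \<Rightarrow> 'a" and g :: "nat \<Rightarrow> 'a"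
  assumes "infinite_dimensional TYPE('a)"
    and "linear_operator D A"
    and "densely_defined D"
    and "closable D A"
  shows "(weak_atomic_system D A g \<longleftrightarrow> weak_frame D A g) \<and>
    (weak_frame D A g \<longleftrightarrow>
      (\<forall>f \<in> adjoint_domain D A. summable (\<lambda>n. (cmod (cinner f (g n)))\<^sup>2)) \<and>
      (\<exists>t. bessel_sequence t \<and> weak_dual D A g t))"
proof -
  have "\<forall>f \<in> adjoint_domain D A. summable (\<lambda>n. (cmod (cinner f (g n)))\<^sup>2)"
    if "weak_frame D A g"
    using that unfolding weak_frame_def by blast
  \<comment> \<open>The implications close the cycle from atomic system to frame to Bessel dual and
    back.\<close>
  then show ?thesis
    using weak_frame_if_weak_atomic_system[OF assms(3)] weak_dual_if_weak_frame[OF assms(3)]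
      weak_atomic_system_if_weak_dual by blast
qed

end
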